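(* Let $G$ be a finite reflection group acting on $\mathbb{R}^n$ with closed fundamental chamber $\mathcal{C}$. Let $f:\mathbb{R}^n\to\mathbb{R}\cup\{+\infty\}$ be invariant under $G$, and assume that $\operatorname{epi}f$ satisfies the following property: for every $(z,\beta)\in\operatorname{bd}\operatorname{epi}f$, the convex hull of the orbit $\{(gz,\beta): g\in G\}$ is contained in $\operatorname{epi}f$. Then for all $x\in\mathbb{R}^n$ with $f(x)<+\infty$ and all $y\in\mathbb{R}^n$, $y\in\partial_p f(x)$ if and only if $$\check y\in\partial_p f(\check x)\quad\text{and}\quad\langle\check x,\check y\rangle=\langle x,y\rangle.$$ Furthermore, $y\in\partial_p^{\infty}f(x)$ if and only if $$\check y\in\partial_p^{\infty}f(\check x)\quad\text{and}\quad\langle\check x,\check y\rangle=\langle x,y\rangle.$$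
   Context: A finite reflection group $G$ on $\mathbb{R}^n$ is a finite subgroup of the orthogonal group $O(n)$ generated by reflections $h_u$, $h_u x=(I-2uu^{T})x$, $u$ a unit vector. Its root system is $\Phi=\{u:\|u\|=1,\ h_u\in G\}$. A positive root system is a set $U\subset\Phi$ for which there is a linear functional $\ell:\mathbb{R}^n\to\mathbb{R}$ with $\ell(u)>0$ for all $u\in U$ and $\ell(u)<0$ for all $u\in\Phi\setminus U$. Fix a positive root system $U$; the closed fundamental chamber is $\mathcal{C}=\{x\in\mathbb{R}^n:\langle x,u\rangle\ge 0\ \forall u\in U\}$. The orbit of $x$ is $\mathcal{O}(x)=\{gx: g\in G\}$. It is a known fact that $\mathcal{O}(x)\cap\mathcal{C}$ is a singleton for every $x\in\mathbb{R}^n$; its unique element is denoted $\check x$. Here $\langle x,y\rangle=x^{T}y$. A function $f$ is invariant under $G$ if $f(gx)=f(x)$ for all $g\in G$, $x\in\mathbb{R}^n$. The action of $G$ is extended to $\mathbb{R}^n\times\mathbb{R}$ by $g(x,\alpha)=(gx,\alpha)$. The epigraph is $\operatorname{epi}f=\{(x,\alpha)\in\mathbb{R}^n\times\mathbb{R}:\alpha\ge f(x)\}$, and $\operatorname{bd}$ is the topological boundary in $\mathbb{R}^{n+1}$. For a set $S\subset\mathbb{R}^{n+1}$, $\mathcal{P}_S(w)=\{s\in S:\|w-s\|=\min_{s'\in S}\|w-s'\|\}$ (Euclidean norm). For $f(x)$ finite, the proximal normal cone to the epigraph is $$\hat N_{\operatorname{epi}f}(x,f(x))=\{(y,\beta):\exists\alpha>0\text{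 such that }(x,f(x))\in\mathcal{P}_{\operatorname{epi}f}((x,f(x))+\alpha(y,\beta))\}.$$ The proximal subdifferential is $\partial_p f(x)=\{y:(y,-1)\in\hat N_{\operatorname{epi}f}(x,f(x))\}$ and the singular proximal subdifferential is $\partial_p^{\infty}f(x)=\{y:(y,0)\in\hat N_{\operatorname{epi}f}(x,f(x))\}$. *)

theory Defs
  imports
    "HOL-Analysis.Analysis"
    "HOL-Algebra.Generated_Groups"
begin

definition orthogonal_group :: "(real ^ 'n ^ 'n) monoid" where
  "orthogonal_group =
    \<lparr>carrier = {A. orthogonal_matrix A}, mult = (\<lambda>A B. A ** B), one = mat 1\<rparr>"

definition reflection :: "real ^ 'n \<Rightarrow> real ^ 'n ^ 'n" where
  "reflection u = mat 1 - 2 *\<^sub>R ((columnvector u :: real ^ 1 ^ 'n) ** rowvector u)"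

lemma reflection_mult_vec:
  fixes u x :: "real ^ 'n"
  shows "reflection u *v x = x - (2 * (u \<bullet> x)) *\<^sub>R u"
proof -
  have "((columnvector u :: real ^ 1 ^ 'n) ** rowvector u) *v x = (u \<bullet> x) *\<^sub>R u"
    by (simp add: vec_eq_iff matrix_vector_mult_def matrix_matrix_mult_def
        columnvector_def rowvector_def inner_vec_def sum_distrib_left mult_ac)
  then show ?thesis
    by (simp add: reflection_def matrix_vector_mult_diff_rdistrib scaleR_matrix_vector_assoc [symmetric])
qed

text \<open>The generating set \<open>R\<close> may be empty, so the trivial group is included.\<close>

definition finite_reflection_group :: "(real ^ 'n ^ 'n) set \<Rightarrow> bool" where
  "finite_reflection_group G \<longleftrightarrow>
    finite G \<and> subgroup G orthogonal_group \<and>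
    (\<exists>R. (\<forall>u\<in>R. norm u = 1) \<and> G = generate orthogonal_group (reflection ` R))"

definition root_system :: "(real ^ 'n ^ 'n) set \<Rightarrow> (real ^ 'n) set" where
  "root_system G = {u. norm u = 1 \<and> reflection u \<in> G}"

definition positive_root_system :: "(real ^ 'n ^ 'n) set \<Rightarrow> (real ^ 'n) set \<Rightarrow> bool" where
  "positive_root_system G U \<longleftrightarrow>
    U \<subseteq> root_system G \<and>
    (\<exists>l :: real ^ 'n \<Rightarrow> real. linear l \<and>
      (\<forall>u\<in>U. l u > 0) \<and> (\<forall>u\<in>root_system G - U. l u < 0))"

definition closed_chamber :: "(real ^ 'n) set \<Rightarrow> (real ^ 'n) set" where
  "closed_chamber U = {x. \<forall>u\<in>U. x \<bullet> u \<ge> 0}"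

definition group_orbit :: "(real ^ 'n ^ 'n) set \<Rightarrow> real ^ 'n \<Rightarrow> (real ^ 'n) set" where
  "group_orbit G x = {g *v x | g. g \<in> G}"

text \<open>
  For a finite reflection group \<open>G\<close> with positive root system \<open>U\<close>, every orbit meets the closed
  chamber in exactly one point, so the description below determines an element.
\<close>

definition chamber_rep ::
  "(real ^ 'n ^ 'n) set \<Rightarrow> (real ^ 'n) set \<Rightarrow> real ^ 'n \<Rightarrow> real ^ 'n" where
  "chamber_rep G U x = (THE z. z \<in> group_orbit G x \<inter> closed_chamber U)"

definition group_invariant :: "(real ^ 'n ^ 'n) set \<Rightarrow> (real ^ 'n \<Rightarrow> 'b) \<Rightarrow> bool" where
  "group_invariant G f \<longleftrightarrow> (\<forall>g\<in>G. \<forall>x. f (g *v x) = f x)"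

definition ext_epigraph :: "('a \<Rightarrow> ereal) \<Rightarrow> ('a \<times> real) set" where
  "ext_epigraph f = {(x, \<alpha>). f x \<le> ereal \<alpha>}"

text \<open>
  On a product of Euclidean spaces the library norm is the Euclidean one, so \<open>proj_set\<close> applied
  to an epigraph is the Euclidean projection in one dimension more.
\<close>

definition proj_set :: "'a::real_normed_vector set \<Rightarrow> 'a \<Rightarrow> 'a set" where
  "proj_set S w = {s \<in> S. \<forall>s'\<in>S. norm (w - s) \<le> norm (w - s')}"

definition prox_normal_cone :: "'a::real_normed_vector set \<Rightarrow> 'a \<Rightarrow> 'a set" where
  "prox_normal_cone S p = {v. \<exists>\<alpha>>0. p \<in> proj_set S (p + \<alpha> *\<^sub>R v)}"

text \<open>
  The two subdifferentials are meaningful only at points where \<open>f\<close> is finite; elsewhere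
  \<^const>\<open>real_of_ereal\<close> returns the default value 0.
\<close>

definition prox_subdiff ::
  "('a::real_normed_vector \<Rightarrow> ereal) \<Rightarrow> 'a \<Rightarrow> 'a set" where
  "prox_subdiff f x = {y. (y, -1) \<in> prox_normal_cone (ext_epigraph f) (x, real_of_ereal (f x))}"

definition sing_prox_subdiff ::
  "('a::real_normed_vector \<Rightarrow> ereal) \<Rightarrow> 'a \<Rightarrow> 'a set" where
  "sing_prox_subdiff f x = {y. (y, 0) \<in> prox_normal_cone (ext_epigraph f) (x, real_of_ereal (f x))}"

end

theory Submission
  imports Defs
begin

text \<open>
  The chamber representative dominates the orbit: \<open>(g x) \<bullet> w \<le> x \<bullet> w\<close> for \<open>x\<close>, \<open>w\<close> in the chamber.
  Hence \<open>x \<bullet> y\<close> never exceeds the inner product of the chamber representatives, and equality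
  forces a single group element to carry both \<open>x\<close> and \<open>y\<close> into the chamber. Since the proximal
  normal cone is equivariant, it remains to see that a proximal normal \<open>(y, b)\<close> at \<open>(x, f x)\<close>
  attains equality. The point \<open>(x, f x)\<close> lies on the boundary of the epigraph, so the epigraph
  contains the segments from it to all \<open>(g x, f x)\<close>; as it is a nearest point of each of them,
  \<open>y \<bullet> g x \<le> y \<bullet> x\<close> for all \<open>g\<close>.
\<close>

text \<open>Otherwise the simplifier turns \<open>transpose g *v x\<close> into a \<open>v*\<close>
  product, and the rules below no longer match.\<close>

declare transpose_matrix_vector [simp del]

section \<open>Orthogonal matrices and reflections\<close>

lemma group_orthogonal_group: "group (orthogonal_group :: (real ^ 'n ^ 'n) monoid)"
proof (rule groupI)
  fix A :: "real ^ 'n ^ 'n"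
  assume "A \<in> carrier orthogonal_group"
  then show "\<exists>B\<in>carrier orthogonal_group. B \<otimes>\<^bsub>orthogonal_group\<^esub> A = \<one>\<^bsub>orthogonal_group\<^esub>"
    by (intro bexI[of _ "transpose A"]) (auto simp: orthogonal_group_def orthogonal_matrix_def)
qed (auto simp: orthogonal_group_def orthogonal_matrix_mul orthogonal_matrix_id matrix_mul_assoc)

lemma inv_orthogonal_group:
  assumes "orthogonal_matrix A"
  shows "inv\<^bsub>orthogonal_group\<^esub> A = transpose A"
  using assms
  by (intro group.inv_equality[OF group_orthogonal_group])
    (auto simp: orthogonal_group_def orthogonal_matrix_def)

lemma inner_orthogonal_matrix:
  fixes A :: "real ^ 'n ^ 'n"
  assumes "orthogonal_matrix A"
  shows "(A *v x) \<bullet> (A *v y) = x \<bullet> y"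
  using assms orthogonal_transformation_matrix[of "(*v) A"]
  by (simp add: orthogonal_transformation_def)

lemma reflection_self:
  assumes "norm u = 1"
  shows "reflection u *v u = - u"
  using assms by (simp add: reflection_mult_vec dot_square_norm scaleR_2)

lemma reflection_involution:
  assumes "norm u = 1"
  shows "reflection u *v (reflection u *v x) = x"
  using assms
  by (simp add: reflection_mult_vec inner_diff_right dot_square_norm scaleR_left_diff_distrib)

lemma reflection_minus: "reflection (- u) = reflection u"
  by (simp add: matrix_eq reflection_mult_vec)

lemma reflection_image:
  assumes "orthogonal_matrix A"
  shows "reflection (A *v u) *v (A *v x) = A *v (reflection u *v x)"
  by (simp add: reflection_mult_vec inner_orthogonal_matrix[OF assms] matrix_vector_mult_diff_distrib
      matrix_vector_mult_scaleR)

lemma reflection_conjugate: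
  assumes "orthogonal_matrix A"
  shows "reflection (A *v u) = A ** reflection u ** transpose A"
proof -
  have "reflection (A *v u) *v x = (A ** reflection u ** transpose A) *v x" for x
  proof -
    have "reflection (A *v u) *v x = reflection (A *v u) *v (A *v (transpose A *v x))"
      using assms
      by (simp add: matrix_vector_mul_assoc orthogonal_matrix_def)
    then show ?thesis
      by (simp add: reflection_image[OF assms] flip: matrix_vector_mul_assoc)
  qed
  then show ?thesis
    by (simp add: matrix_eq)
qed

text \<open>Evaluating at \<open>u\<close> shows that a reflection determines its unit vector up to
  sign. Finiteness of the root system rests on this.\<close>

lemma finite_unit_reflection_eq: "finite {u :: real ^ 'n. norm u = 1 \<and> reflection u = A}"
proof (cases "\<exists>v :: real ^ 'n. norm v = 1 \<and> reflection v = A")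
  case True
  then obtain v where v: "norm v = 1" "reflection v = A"
    by blast
  have "u \<in> {v, - v}" if "norm u = 1" "reflection u = A" for u
  proof -
    have "u - (2 * (v \<bullet> u)) *\<^sub>R v = - u"
      using that v reflection_self[of u] by (simp flip: reflection_mult_vec)
    then have "2 *\<^sub>R u = 2 *\<^sub>R ((v \<bullet> u) *\<^sub>R v)"
      by (simp add: algebra_simps scaleR_2)
    then have eq: "u = (v \<bullet> u) *\<^sub>R v"
      by (metis scaleR_cancel_left zero_neq_numeral)
    then have "\<bar>v \<bullet> u\<bar> = 1"
      using that v by (metis norm_scaleR mult.right_neutral)
    then show ?thesis
      using eq by (smt (verit) insertCI scaleR_minus1_left scaleR_one)
  qed
  then show ?thesis
    by (auto intro: finite_subset[of _ "{v, - v}"])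
next
  case False
  then have "{u :: real ^ 'n. norm u = 1 \<and> reflection u = A} = {}"
    by blast
  then show ?thesis
    by (simp only: finite.emptyI)
qed

lemma finite_root_system:
  assumes "finite G"
  shows "finite (root_system G)"
proof -
  have "root_system G = (\<Union>A\<in>G. {u. norm u = 1 \<and> reflection u = A})"
    by (auto simp: root_system_def)
  then show ?thesis
    using assms finite_unit_reflection_eq by auto
qed

text \<open>The square of \<open>norm (x - y)\<close> is
  \<open>2 * (x \<bullet> x - x \<bullet> y)\<close>. This turns dominance inequalities between
  vectors of equal norm into equalities.\<close>

lemma eq_if_inner_ge:
  fixes x y :: "'a::real_inner"
  assumes "norm x = norm y" and "x \<bullet> x \<le> x \<bullet> y"
  shows "x = y"
proof -
  have "x \<bullet> x = y \<bullet> y"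
    using assms by (simp add: dot_square_norm)
  then have "(x - y) \<bullet> (x - y) \<le> 0"
    using assms by (simp add: inner_diff inner_commute)
  then have "(x - y) \<bullet> (x - y) = 0"
    using inner_ge_zero[of "x - y"] by linarith
  then show ?thesis
    by simp
qed

text \<open>The last letter acts first, so \<open>as @ bs\<close> acts as \<open>as\<close> after
  \<open>bs\<close>.\<close>

abbreviation reflect_word :: "(real ^ 'n) list \<Rightarrow> real ^ 'n \<Rightarrow> real ^ 'n" where
  "reflect_word \<equiv> foldr (\<lambda>a x. reflection a *v x)"

lemma reflect_word_rev:
  assumes "\<forall>a\<in>set as. norm a = 1"
  shows "reflect_word as (reflect_word (rev as) x) = x"
  using assms by (induction as arbitrary: x) (auto simp: reflection_involution)

section \<open>Roots and the height defined by a positive root system\<close>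

locale reflection_chamber =
  fixes G :: "(real ^ 'n ^ 'n) set" and U :: "(real ^ 'n) set"
  assumes reflection_group: "finite_reflection_group G"
    and positive_roots: "positive_root_system G U"
begin

lemma finite_G: "finite G"
  and subgroup_G: "subgroup G orthogonal_group"
  using reflection_group by (auto simp: finite_reflection_group_def)

lemma orthogonal_G: "g \<in> G \<Longrightarrow> orthogonal_matrix g"
  using subgroup.subset[OF subgroup_G] by (auto simp: orthogonal_group_def)

lemma mult_G: "g \<in> G \<Longrightarrow> h \<in> G \<Longrightarrow> g ** h \<in> G"
  using subgroup.m_closed[OF subgroup_G] by (simp add: orthogonal_group_def)

lemma one_G: "mat 1 \<in> G"
  using subgroup.one_closed[OF subgroup_G] by (simp add: orthogonal_group_def)

lemma transpose_G: "g \<in> G \<Longrightarrow> transpose g \<in> G"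
  using subgroup.m_inv_closed[OF subgroup_G] by (metis inv_orthogonal_group orthogonal_G)

lemma transpose_cancel:
  assumes "g \<in> G"
  shows "transpose g *v (g *v x) = x" "g *v (transpose g *v x) = x"
  using orthogonal_G[OF assms]
  by (simp_all add: matrix_vector_mul_assoc orthogonal_matrix_def)

lemma inner_G: "g \<in> G \<Longrightarrow> (g *v x) \<bullet> (g *v y) = x \<bullet> y"
  by (simp add: inner_orthogonal_matrix orthogonal_G)

lemma inner_transpose_G: "g \<in> G \<Longrightarrow> (g *v x) \<bullet> y = x \<bullet> (transpose g *v y)"
  by (metis inner_G transpose_cancel(2))

lemma norm_G: "g \<in> G \<Longrightarrow> norm (g *v x) = norm x"
  by (simp add: norm_eq_sqrt_inner inner_G)

lemma root_image: "g \<in> G \<Longrightarrow> u \<in> root_system G \<Longrightarrow> g *v u \<in> root_system G"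
  by (simp add: root_system_def norm_G reflection_conjugate orthogonal_G mult_G transpose_G)

lemma root_minus: "u \<in> root_system G \<Longrightarrow> - u \<in> root_system G"
  by (simp add: root_system_def reflection_minus)

text \<open>A vector representing a functional that cuts out \<open>U\<close>. It lies strictly
  inside the chamber, and \<open>pole \<bullet> u\<close> serves as the height of a root in the
  minimality arguments.\<close>

definition pole :: "real ^ 'n" where
  "pole = (SOME p. (\<forall>u\<in>U. p \<bullet> u > 0) \<and> (\<forall>u\<in>root_system G - U. p \<bullet> u < 0))"

lemma pole_pos: "u \<in> U \<Longrightarrow> pole \<bullet> u > 0"
  and pole_neg: "u \<in> root_system G \<Longrightarrow> u \<notin> U \<Longrightarrow> pole \<bullet> u < 0"
proof -
  obtain l :: "real ^ 'n \<Rightarrow> real" where l: "linear l" "\<forall>u\<in>U. l u > 0"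
    "\<forall>u\<in>root_system G - U. l u < 0"
    using positive_roots by (auto simp: positive_root_system_def)
  have "l u = adjoint l 1 \<bullet> u" for u
    using adjoint_works[OF l(1), of u 1] by (simp add: inner_commute)
  then have "\<exists>p. (\<forall>u\<in>U. p \<bullet> u > 0) \<and> (\<forall>u\<in>root_system G - U. p \<bullet> u < 0)"
    using l by auto
  from someI_ex[OF this] show "u \<in> U \<Longrightarrow> pole \<bullet> u > 0"
    and "u \<in> root_system G \<Longrightarrow> u \<notin> U \<Longrightarrow> pole \<bullet> u < 0"
    by (auto simp: pole_def)
qed

lemma root_U: "u \<in> U \<Longrightarrow> u \<in> root_system G"
  using positive_roots by (auto simp: positive_root_system_def)

lemma norm_U: "u \<in> U \<Longrightarrow> norm u = 1"
  and reflection_U: "u \<in> U \<Longrightarrow> reflection u \<in> G"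
  using root_U by (auto simp: root_system_def)

lemma minus_U_iff: "u \<in> root_system G \<Longrightarrow> - u \<in> U \<longleftrightarrow> u \<notin> U"
  by (metis inner_minus_right neg_less_0_iff_less order.asym pole_neg pole_pos root_minus)

lemma finite_U: "finite U"
  using finite_subset[OF _ finite_root_system[OF finite_G]] root_U by blast

section \<open>Simple roots, words in simple reflections, exchange and deletion\<close>

text \<open>
  This property of simple roots is all that the word arguments need; it avoids bases of the
  root system and the linear independence of the usual simple roots.
\<close>

definition simple_roots :: "(real ^ 'n) set" where
  "simple_roots = {a \<in> U. \<forall>v\<in>U. v \<noteq> a \<longrightarrow> reflection a *v v \<in> U}"

lemma simple_root_separates:
  assumes "u \<in> U" and "x \<bullet> u < 0"
  obtains a where "a \<in> simple_roots" and "x \<bullet> a < 0"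
proof -
  \<comment> \<open>Among the positive roots with minimal ratio \<open>(x \<bullet> v) / (pole \<bullet> v)\<close>, take \<open>a\<close> with minimal
    \<open>pole \<bullet> a\<close>. If \<open>a\<close> is not simple, then \<open>c a = v + w\<close> with positive roots \<open>v \<noteq> a\<close> and \<open>w\<close>, whose
    ratios are minimal as well by the mediant inequality, so \<open>c \<ge> 2\<close>; but \<open>c = 2 (a \<bullet> v) < 2\<close>.\<close>
  define r where "r v = (x \<bullet> v) / (pole \<bullet> v)" for v
  define m where "m = Min (r ` U)"
  define M where "M = {v \<in> U. r v = m}"
  have m_le: "m \<le> r v" if "v \<in> U" for v
    using that finite_U by (simp add: m_def)
  have "m \<in> r ` U"
    unfolding m_def using finite_U assms(1) by (intro Min_in) auto
  then have M: "finite M" "M \<noteq> {}"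
    using finite_U by (auto simp: M_def)
  obtain a where a: "a \<in> M" and a_min: "\<And>v. v \<in> M \<Longrightarrow> pole \<bullet> a \<le> pole \<bullet> v"
    using M by (metis (no_types, lifting) arg_min_if_finite(1) arg_min_least)
  have aU: "a \<in> U" and ra: "r a = m"
    using a by (auto simp: M_def)
  have "r u < 0"
    using assms pole_pos by (simp add: r_def divide_neg_pos)
  then have "m < 0"
    using m_le[OF assms(1)] by simp
  then have neg: "x \<bullet> a < 0"
    using ra pole_pos[OF aU] by (auto simp: r_def divide_less_0_iff)
  have "reflection a *v v \<in> U" if v: "v \<in> U" "v \<noteq> a" for v
  proof (rule ccontr)
    assume "reflection a *v v \<notin> U"
    define c where "c = 2 * (a \<bullet> v)"
    define w where "w = c *\<^sub>R a - v"
    have "w = - (reflection a *v v)"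
      by (simp add: w_def c_def reflection_mult_vec)
    then have w: "w \<in> U"
      using \<open>reflection a *v v \<notin> U\<close> minus_U_iff root_image[OF reflection_U[OF aU] root_U[OF v(1)]]
      by simp
    have sum: "c *\<^sub>R a = v + w"
      by (simp add: w_def)
    have "c * (pole \<bullet> a) = pole \<bullet> v + pole \<bullet> w"
      using arg_cong[OF sum, of "\<lambda>z. pole \<bullet> z"] by (simp add: inner_add_right)
    moreover have "c * (x \<bullet> a) = x \<bullet> v + x \<bullet> w"
      using arg_cong[OF sum, of "\<lambda>z. x \<bullet> z"] by (simp add: inner_add_right)
    moreover have pos: "pole \<bullet> a > 0" "pole \<bullet> v > 0" "pole \<bullet> w > 0"
      using pole_pos aU v w by auto
    moreover have "x \<bullet> a = m * (pole \<bullet> a)"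
      using ra pos by (simp add: r_def field_simps)
    moreover have "x \<bullet> v \<ge> m * (pole \<bullet> v)" "x \<bullet> w \<ge> m * (pole \<bullet> w)"
      using m_le[of v] m_le[of w] v w pos by (simp_all add: r_def field_simps)
    ultimately have "x \<bullet> v = m * (pole \<bullet> v)" "x \<bullet> w = m * (pole \<bullet> w)"
      and pc: "c * (pole \<bullet> a) = pole \<bullet> v + pole \<bullet> w"
      by (auto simp: algebra_simps) (smt (verit) distrib_left mult.left_commute)+
    then have "v \<in> M" "w \<in> M"
      using v w pos by (auto simp: M_def r_def)
    then have "2 * (pole \<bullet> a) \<le> c * (pole \<bullet> a)"
      using a_min[of v] a_min[of w] pc by simp
    then have "a \<bullet> v \<ge> 1"
      using pos by (simp add: c_def)
    moreover have "a \<bullet> v \<le> norm a * norm v"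
      by (rule norm_cauchy_schwarz)
    ultimately have "a \<bullet> v = norm a * norm v"
      using norm_U aU v by simp
    then have "norm a *\<^sub>R v = norm v *\<^sub>R a"
      using norm_cauchy_schwarz_eq by blast
    then have "v = a"
      using norm_U aU v by simp
    with v show False by simp
  qed
  then show thesis
    using that aU neg by (auto simp: simple_roots_def)
qed

lemma simple_root_U: "a \<in> simple_roots \<Longrightarrow> a \<in> U"
  by (simp add: simple_roots_def)

lemma reflect_word_matrix:
  assumes "set as \<subseteq> root_system G"
  obtains g where "g \<in> G" and "\<And>x. reflect_word as x = g *v x"
  using assms
proof (induction as arbitrary: thesis)
  case Nil
  then show ?case
    using one_G by (metis foldr_Nil id_apply matrix_vector_mul_lid)
next
  case (Cons a as)
  then obtain g where "g \<in> G" "\<And>x. reflect_word as x = g *v x"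
    by auto
  then show ?case
    using Cons.prems mult_G[of "reflection a" g]
    by (auto simp: matrix_vector_mul_assoc root_system_def)
qed

text \<open>Simple reflections lower the height of a root until a simple root \<open>v\<close> is
  reached; the word leading back from \<open>v\<close> to \<open>u\<close> conjugates the reflection
  in \<open>v\<close> to the one in \<open>u\<close>.\<close>

lemma reflection_simple_word:
  assumes "u \<in> U"
  obtains as where "set as \<subseteq> simple_roots" and "\<And>x. reflection u *v x = reflect_word as x"
proof -
  define V where "V = {v \<in> U. \<exists>as. set as \<subseteq> simple_roots \<and> reflect_word as v = u}"
  have "u \<in> V"
    unfolding V_def using assms by (auto intro!: exI[of _ "[]"])
  moreover have "finite V"
    using finite_U by (simp add: V_def)
  ultimately obtain v where v: "v \<in> V" and v_min: "\<And>w. w \<in> V \<Longrightarrow> pole \<bullet> v \<le> pole \<bullet> w"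
    by (metis (no_types, lifting) arg_min_if_finite(1) arg_min_least empty_iff)
  obtain as where as: "set as \<subseteq> simple_roots" "reflect_word as v = u" and vU: "v \<in> U"
    using v by (auto simp: V_def)
  have "v \<in> simple_roots"
  proof (rule ccontr)
    assume notin: "v \<notin> simple_roots"
    \<comment> \<open>Separation at the point \<open>- v\<close> yields a simple root
      \<open>a\<close> with \<open>v \<bullet> a > 0\<close>, and reflecting \<open>v\<close> in
      \<open>a\<close> lowers its height.\<close>
    have "- v \<bullet> v < 0"
      using norm_U[OF vU] by (simp add: dot_square_norm)
    then obtain a where a: "a \<in> simple_roots" "- v \<bullet> a < 0"
      using simple_root_separates[OF vU] by blast
    have "a \<noteq> v"
      using notin a by auto
    then have "reflection a *v v \<in> U"
      using a vU by (auto simp: simple_roots_def)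
    moreover have "reflect_word (as @ [a]) (reflection a *v v) = u"
      using as a norm_U simple_root_U by (simp add: reflection_involution)
    ultimately have "reflection a *v v \<in> V"
      using as a unfolding V_def by (auto intro!: exI[of _ "as @ [a]"])
    then have "pole \<bullet> v \<le> pole \<bullet> (reflection a *v v)"
      by (rule v_min)
    then show False
      using a pole_pos[OF simple_root_U[OF a(1)]]
      by (simp add: reflection_mult_vec inner_diff_right inner_commute mult_le_0_iff)
  qed
  obtain g where g: "g \<in> G" "\<And>x. reflect_word as x = g *v x"
    using reflect_word_matrix[of as] as simple_root_U root_U by blast
  have "reflection u *v x = reflect_word (as @ v # rev as) x" for x
  proof -
    have "reflection u *v x = reflection (g *v v) *v (g *v reflect_word (rev as) x)"
      using as g reflect_word_rev[of as x] norm_U simple_root_U by (metis subsetD)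
    then show ?thesis
      using g by (simp add: reflection_image orthogonal_G)
  qed
  then show thesis
    using that[of "as @ v # rev as"] as \<open>v \<in> simple_roots\<close> by auto
qed

text \<open>A generator may come from a negative root, but \<open>u\<close> and \<open>- u\<close>
  give the same reflection; since reflections are involutions, inverses of generators need no new
  words.\<close>

lemma simple_word:
  assumes "g \<in> G"
  obtains as where "set as \<subseteq> simple_roots" and "\<And>x. g *v x = reflect_word as x"
proof -
  obtain R where R: "\<forall>u\<in>R. norm u = 1" "G = generate orthogonal_group (reflection ` R)"
    using reflection_group by (auto simp: finite_reflection_group_def)
  have root: "u \<in> root_system G" if "u \<in> R" for u
    using R that by (auto simp: root_system_def intro: generate.incl)
  have refl_word: "\<exists>as. set as \<subseteq> simple_roots \<and> (\<forall>x. reflection u *v x = reflect_word as x)"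
    if "u \<in> R" for u
  proof (cases "u \<in> U")
    case True
    then show ?thesis
      using reflection_simple_word by metis
  next
    case False
    then show ?thesis
      using reflection_simple_word[of "- u"] minus_U_iff root[OF that] reflection_minus by metis
  qed
  have "g \<in> generate orthogonal_group (reflection ` R)"
    using assms R by simp
  then have "\<exists>as. set as \<subseteq> simple_roots \<and> (\<forall>x. g *v x = reflect_word as x)"
  proof (induction rule: generate.induct)
    case one
    show ?case
      by (intro exI[of _ "[]"]) (simp add: orthogonal_group_def)
  next
    case (incl h)
    then show ?case
      using refl_word by auto
  next
    case (inv h)
    then obtain u where u: "u \<in> R" "h = reflection u"
      by auto
    have "h \<in> G"
      using u root by (auto simp: root_system_def)
    have "transpose h *v x = h *v x" for x
      using u R reflection_involution[of u x] transpose_cancel(1)[OF \<open>h \<in> G\<close>] by metis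
    then show ?case
      using refl_word u inv_orthogonal_group orthogonal_G[OF \<open>h \<in> G\<close>] by metis
  next
    case (eng h k)
    then obtain as bs where "set as \<subseteq> simple_roots" "\<forall>x. h *v x = reflect_word as x"
      "set bs \<subseteq> simple_roots" "\<forall>x. k *v x = reflect_word bs x"
      by auto
    then show ?case
      by (intro exI[of _ "as @ bs"])
        (simp add: orthogonal_group_def flip: matrix_vector_mul_assoc)
  qed
  then show thesis
    using that by blast
qed

text \<open>As the letters act in turn, the image of \<open>b\<close> leaves \<open>U\<close> at
  some letter \<open>a\<close>. A simple reflection can send only its own root out of
  \<open>U\<close>, so just before that step the image is \<open>a\<close>.\<close>

lemma word_exchange:
  assumes "set as \<subseteq> simple_roots" and "b \<in> U" and "reflect_word as b \<notin> U"
  shows "\<exists>bs a cs. as = bs @ a # cs \<and> reflect_word cs b = a"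
  using assms
proof (induction as)
  case (Cons a as)
  show ?case
  proof (cases "reflect_word as b \<in> U")
    case True
    then have "reflect_word as b = a"
      using Cons.prems by (auto simp: simple_roots_def)
    then show ?thesis
      by (intro exI[of _ "[]"]) auto
  next
    case False
    then obtain bs a' cs where "as = bs @ a' # cs \<and> reflect_word cs b = a'"
      using Cons by auto
    then show ?thesis
      by (intro exI[of _ "a # bs"]) auto
  qed
qed simp

text \<open>
  Deletion: if \<open>b\<close> is the last letter, then the exchange gives an earlier letter \<open>a\<close> that is the
  image of \<open>b\<close> under the letters between them, so \<open>a\<close> and \<open>b\<close> cancel.
\<close>

lemma word_preserving_positive:
  assumes "set as \<subseteq> simple_roots" and "\<And>u. u \<in> U \<Longrightarrow> reflect_word as u \<in> U"
  shows "reflect_word as x = x"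
  using assms
proof (induction "length as" arbitrary: as rule: less_induct)
  case less
  show ?case
  proof (cases as rule: rev_cases)
    case (snoc ts b)
    have b: "b \<in> U" and ts: "set ts \<subseteq> simple_roots"
      using less.prems snoc simple_root_U by auto
    obtain h where h: "h \<in> G" "\<And>x. reflect_word ts x = h *v x"
      using reflect_word_matrix[of ts] ts simple_root_U root_U by blast
    \<comment> \<open>The last letter acts first and negates \<open>b\<close>.\<close>
    have "reflect_word as b = - reflect_word ts b"
      using h norm_U[OF b]
      by (simp add: snoc reflection_self linear_neg[OF matrix_vector_mul_linear])
    then have "reflect_word ts b \<notin> U"
      using less.prems(2)[OF b] minus_U_iff h root_image root_U[OF b] by metis
    then obtain bs a cs where split: "ts = bs @ a # cs" "reflect_word cs b = a"
      using word_exchange[OF ts b] by blast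
    obtain k where k: "k \<in> G" "\<And>x. reflect_word cs x = k *v x"
      using reflect_word_matrix[of cs] ts split simple_root_U root_U
      by (metis (no_types, lifting) set_append set_subset_Cons subset_trans sup.boundedE subsetI subsetD)
    have shorter: "reflect_word as x = reflect_word (bs @ cs) x" for x
    proof -
      have "reflect_word cs (reflection b *v x) = reflection a *v reflect_word cs x"
        using k split(2) by (simp add: reflection_image orthogonal_G flip: split(2))
      moreover have "norm a = 1"
        using ts split norm_U simple_root_U by auto
      ultimately show ?thesis
        by (simp add: snoc split(1) reflection_involution)
    qed
    have "reflect_word (bs @ cs) x = x"
      using less.prems ts split shorter by (intro less.hyps) (auto simp: snoc)
    then show ?thesis
      by (simp add: shorter)
  qed simp
qed

text \<open>For \<open>u\<close> in \<open>U\<close>,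
  \<open>pole \<bullet> (transpose g *v u)\<close> equals \<open>(g *v pole) \<bullet> u\<close> and
  is not negative. So \<open>transpose g\<close> preserves \<open>U\<close>, and its word acts
  trivially.\<close>

lemma pole_image_chamber:
  assumes "g \<in> G" and "g *v pole \<in> closed_chamber U"
  shows "g *v x = x"
proof -
  obtain as where as: "set as \<subseteq> simple_roots" "\<And>x. transpose g *v x = reflect_word as x"
    using simple_word[OF transpose_G[OF assms(1)]] by metis
  have "transpose g *v u \<in> U" if "u \<in> U" for u
  proof (rule ccontr)
    assume "transpose g *v u \<notin> U"
    then have "pole \<bullet> (transpose g *v u) < 0"
      by (intro pole_neg root_image transpose_G assms(1) root_U that)
    moreover have "(g *v pole) \<bullet> u \<ge> 0"
      using assms(2) that by (simp add: closed_chamber_def)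
    ultimately show False
      by (simp add: inner_transpose_G[OF assms(1)])
  qed
  then have "transpose g *v (g *v x) = g *v x"
    using word_preserving_positive as by auto
  then show ?thesis
    by (simp add: transpose_cancel[OF assms(1)])
qed

section \<open>Dominance in the chamber and chamber representatives\<close>

text \<open>
  If \<open>g\<close> moves the pole out of the chamber, then composing \<open>g\<close> with a reflection in a violated
  wall brings the image of the pole closer to the pole and does not decrease the left-hand side.
\<close>

lemma inner_le_chamber:
  assumes "g \<in> G" and x: "x \<in> closed_chamber U" and w: "w \<in> closed_chamber U"
  shows "(g *v x) \<bullet> w \<le> x \<bullet> w"
  using assms(1)
proof (induction "card {h \<in> G. (h *v pole) \<bullet> pole > (g *v pole) \<bullet> pole}" arbitrary: g rule: less_induct)
  case less
  show ?case
  proof (cases "g *v pole \<in> closed_chamber U")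
    case True
    then show ?thesis
      by (simp add: pole_image_chamber[OF less.prems True])
  next
    case False
    then obtain u where u: "u \<in> U" "(g *v pole) \<bullet> u < 0"
      by (auto simp: closed_chamber_def not_le)
    define h where "h = reflection u ** g"
    have h: "h *v z = g *v z - (2 * (u \<bullet> (g *v z))) *\<^sub>R u" for z
      by (simp add: h_def reflection_mult_vec flip: matrix_vector_mul_assoc)
    have hG: "h \<in> G"
      using u reflection_U less.prems by (simp add: h_def mult_G)
    have "(h *v pole) \<bullet> pole > (g *v pole) \<bullet> pole"
      using u pole_pos[OF u(1)]
      by (simp add: h inner_diff_left inner_diff_right inner_commute mult_less_0_iff)
    \<comment> \<open>\<open>h\<close> itself is counted for \<open>g\<close> but not for
      \<open>h\<close>, hence the strict decrease.\<close>
    then have "card {k \<in> G. (k *v pole) \<bullet> pole > (h *v pole) \<bullet> pole}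
        < card {k \<in> G. (k *v pole) \<bullet> pole > (g *v pole) \<bullet> pole}"
      using finite_G hG by (intro psubset_card_mono) auto
    then have IH: "(h *v x) \<bullet> w \<le> x \<bullet> w"
      using less.hyps hG by blast
    have tu: "transpose g *v u \<in> root_system G"
      using root_image transpose_G less.prems root_U u by blast
    \<comment> \<open>The pole is on the negative side of the root \<open>transpose g *v u\<close>,
      hence so is, weakly, the chamber point \<open>x\<close>.\<close>
    have "pole \<bullet> (transpose g *v u) < 0"
      using u less.prems by (simp add: inner_transpose_G)
    then have "transpose g *v u \<notin> U"
      using pole_pos by fastforce
    then have "- (transpose g *v u) \<in> U"
      using tu minus_U_iff by blast
    then have "x \<bullet> - (transpose g *v u) \<ge> 0"
      using x unfolding closed_chamber_def by blast
    then have "(g *v x) \<bullet> u \<le> 0"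
      using less.prems by (simp add: inner_transpose_G)
    moreover have "w \<bullet> u \<ge> 0"
      using w u by (simp add: closed_chamber_def)
    \<comment> \<open>\<open>h *v x\<close> is \<open>g *v x\<close> plus a nonnegative multiple of
      \<open>u\<close>.\<close>
    ultimately have "(g *v x) \<bullet> w \<le> (h *v x) \<bullet> w"
      by (simp add: h inner_diff_right inner_commute mult_le_0_iff)
    with IH show ?thesis
      by simp
  qed
qed

text \<open>Existence: an orbit point closest to the pole lies in the chamber, since reflecting in a
  violated wall would bring it closer. Uniqueness: dominance together with equal norms.\<close>

lemma orbit_chamber_singleton: "\<exists>!z. z \<in> group_orbit G x \<inter> closed_chamber U"
proof -
  have fin: "finite ((\<lambda>g. pole \<bullet> (g *v x)) ` G)"
    using finite_G by simp
  have "Max ((\<lambda>g. pole \<bullet> (g *v x)) ` G) \<in> (\<lambda>g. pole \<bullet> (g *v x)) ` G"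
    using fin one_G by (intro Max_in) auto
  then obtain g where g: "g \<in> G" "Max ((\<lambda>g. pole \<bullet> (g *v x)) ` G) = pole \<bullet> (g *v x)"
    by auto
  have max: "pole \<bullet> (h *v x) \<le> pole \<bullet> (g *v x)" if "h \<in> G" for h
    using that fin by (simp flip: g(2))
  have "(g *v x) \<bullet> u \<ge> 0" if "u \<in> U" for u
  proof -
    have "pole \<bullet> ((reflection u ** g) *v x) \<le> pole \<bullet> (g *v x)"
      by (intro max mult_G reflection_U g that)
    then show ?thesis
      using pole_pos[OF that]
      by (simp add: reflection_mult_vec inner_diff_right inner_commute zero_le_mult_iff
          flip: matrix_vector_mul_assoc)
  qed
  then have "g *v x \<in> group_orbit G x \<inter> closed_chamber U"
    using g by (auto simp: group_orbit_def closed_chamber_def)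
  moreover have "y = z" if yz: "y \<in> group_orbit G x \<inter> closed_chamber U"
    "z \<in> group_orbit G x \<inter> closed_chamber U" for y z
  proof -
    obtain g h where gh: "g \<in> G" "h \<in> G" "y = g *v x" "z = h *v x"
      using yz unfolding group_orbit_def by blast
    have "y = (g ** transpose h) *v z"
      using gh by (simp add: transpose_cancel flip: matrix_vector_mul_assoc)
    then have "y \<bullet> y \<le> z \<bullet> y"
      using inner_le_chamber[of "g ** transpose h" z y] gh yz by (auto intro: mult_G transpose_G)
    then show ?thesis
      using gh by (intro eq_if_inner_ge[of y z]) (auto simp: norm_G inner_commute)
  qed
  ultimately show ?thesis
    by blast
qed

lemma chamber_rep_chamber: "chamber_rep G U x \<in> closed_chamber U"
  and chamber_rep_orbit: "\<exists>g\<in>G. chamber_rep G U x = g *v x"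
  using theI'[OF orbit_chamber_singleton[of x]]
  by (auto simp: chamber_rep_def group_orbit_def)

lemma norm_chamber_rep: "norm (chamber_rep G U x) = norm x"
  using chamber_rep_orbit[of x] norm_G by auto

lemma inner_le_chamber_rep:
  assumes "w \<in> closed_chamber U" and "g \<in> G"
  shows "(g *v x) \<bullet> w \<le> chamber_rep G U x \<bullet> w"
proof -
  obtain h where h: "h \<in> G" "chamber_rep G U x = h *v x"
    using chamber_rep_orbit by blast
  have "g *v x = (g ** transpose h) *v chamber_rep G U x"
    using h by (simp add: transpose_cancel flip: matrix_vector_mul_assoc)
  then show ?thesis
    using inner_le_chamber[OF _ chamber_rep_chamber assms(1), of "g ** transpose h" x] h assms(2)
    by (simp add: mult_G transpose_G)
qed

text \<open>Moving \<open>y\<close> into the chamber takes \<open>x\<close> along its orbit, where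
  dominance applies.\<close>

lemma inner_le_inner_chamber_rep: "x \<bullet> y \<le> chamber_rep G U x \<bullet> chamber_rep G U y"
proof -
  obtain h where h: "h \<in> G" "chamber_rep G U y = h *v y"
    using chamber_rep_orbit by blast
  then have "x \<bullet> y = (h *v x) \<bullet> chamber_rep G U y"
    by (simp add: inner_G)
  then show ?thesis
    using inner_le_chamber_rep[OF chamber_rep_chamber h(1)] by simp
qed

lemma simultaneous_chamber_rep:
  assumes "chamber_rep G U x \<bullet> chamber_rep G U y = x \<bullet> y"
  obtains g where "g \<in> G" and "g *v x = chamber_rep G U x" and "g *v y = chamber_rep G U y"
proof -
  \<comment> \<open>The element carrying \<open>x + y\<close> into the chamber works: by dominance and the equality case of the
    Cauchy-Schwarz inequality, the representative of \<open>x + y\<close> is the sum of the representatives.\<close>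
  let ?x = "chamber_rep G U x" and ?y = "chamber_rep G U y"
  obtain g where g: "g \<in> G" "chamber_rep G U (x + y) = g *v (x + y)"
    using chamber_rep_orbit by blast
  define z where "z = chamber_rep G U (x + y)"
  have z: "z = g *v x + g *v y"
    by (simp add: z_def g matrix_vector_right_distrib)
  have sq: "?x \<bullet> ?x = x \<bullet> x" "?y \<bullet> ?y = y \<bullet> y"
    by (simp_all add: dot_square_norm norm_chamber_rep)
  have "z \<bullet> z = (x + y) \<bullet> (x + y)"
    by (simp add: z_def dot_square_norm norm_chamber_rep)
  also have "\<dots> = (?x + ?y) \<bullet> (?x + ?y)"
    using assms sq by (simp add: inner_add inner_commute)
  finally have "norm z = norm (?x + ?y)"
    by (simp add: norm_eq_sqrt_inner)
  moreover have "z \<bullet> z \<le> z \<bullet> (?x + ?y)"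
  proof -
    have "z \<in> closed_chamber U"
      by (simp add: z_def chamber_rep_chamber)
    then have "(g *v x) \<bullet> z \<le> ?x \<bullet> z" "(g *v y) \<bullet> z \<le> ?y \<bullet> z"
      using g by (auto intro: inner_le_chamber_rep)
    moreover have "z \<bullet> z = (g *v x) \<bullet> z + (g *v y) \<bullet> z"
      by (metis z inner_add_left)
    ultimately show ?thesis
      by (simp add: inner_add inner_commute)
  qed
  ultimately have zxy: "z = ?x + ?y"
    by (rule eq_if_inner_ge)
  \<comment> \<open>Pair \<open>g *v x\<close> with both expressions for \<open>z\<close>. The
    second summand on the left is dominated, so the first cannot fall below
    \<open>?x \<bullet> ?x\<close>.\<close>
  have "(g *v x) \<bullet> ?x + (g *v x) \<bullet> ?y = ?x \<bullet> ?x + ?x \<bullet> ?y"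
  proof -
    have "(g *v x) \<bullet> z = x \<bullet> x + x \<bullet> y"
      by (simp add: z inner_add_right inner_G g)
    then show ?thesis
      using assms sq by (simp add: zxy inner_add_right)
  qed
  moreover have "(g *v x) \<bullet> ?y \<le> ?x \<bullet> ?y"
    by (intro inner_le_chamber_rep chamber_rep_chamber g)
  ultimately have "?x \<bullet> ?x \<le> ?x \<bullet> (g *v x)"
    by (simp add: inner_commute)
  then have gx: "?x = g *v x"
    by (intro eq_if_inner_ge[of ?x "g *v x"]) (simp_all add: norm_chamber_rep norm_G g)
  then have "g *v y = ?y"
    using z zxy by simp
  then show thesis
    using that g gx by simp
qed

end

section \<open>Proximal normals to epigraphs\<close>

lemma prox_normal_cone_epigraph_iff:
  "(y, b) \<in> prox_normal_cone (ext_epigraph f) (x, c) \<longleftrightarrow>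
    f x \<le> ereal c \<and> (\<exists>\<alpha>>0. \<forall>z d. f z \<le> ereal d \<longrightarrow>
      norm (\<alpha> *\<^sub>R y, \<alpha> * b) \<le> norm (x + \<alpha> *\<^sub>R y - z, c + \<alpha> * b - d))"
  by (simp add: prox_normal_cone_def proj_set_def ext_epigraph_def del: norm_scaleR) blast

text \<open>\<open>g\<close> acts isometrically, fixes the last coordinate and maps the epigraph
  onto itself, so nearest points go to nearest points.\<close>

lemma prox_normal_cone_epigraph_group:
  fixes G :: "(real ^ 'n ^ 'n) set"
  assumes inv: "group_invariant G f" and g: "g \<in> G" "orthogonal_matrix g"
  shows "(g *v y, b) \<in> prox_normal_cone (ext_epigraph f) (g *v x, c) \<longleftrightarrow>
    (y, b) \<in> prox_normal_cone (ext_epigraph f) (x, c)"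
proof -
  have f: "f (g *v z) = f z" for z
    using inv g by (simp add: group_invariant_def)
  have norm: "norm (g *v z) = norm z" for z
    by (simp add: norm_eq_sqrt_inner inner_orthogonal_matrix g)
  have surj: "(\<forall>z. P z) \<longleftrightarrow> (\<forall>z. P (g *v z))" for P
    using g(2) by (metis matrix_vector_mul_assoc matrix_vector_mul_lid orthogonal_matrix_def)
  have "norm (g *v x + \<alpha> *\<^sub>R (g *v y) - g *v z, s) = norm (x + \<alpha> *\<^sub>R y - z, s)" for \<alpha> z and s :: real
    using norm[of "x + \<alpha> *\<^sub>R y - z"]
    by (simp add: norm_Pair matrix_vector_mult_diff_distrib matrix_vector_right_distrib
        matrix_vector_mult_scaleR)
  moreover have "norm (\<alpha> *\<^sub>R (g *v y), s) = norm (\<alpha> *\<^sub>R y, s)" for \<alpha> and s :: real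
    by (simp add: norm_Pair norm)
  ultimately show ?thesis
    unfolding prox_normal_cone_epigraph_iff
    \<comment> \<open>\<open>surj\<close> reindexes the competing points of the epigraph by
      \<open>g\<close>.\<close>
    by (subst surj) (simp add: f)
qed

text \<open>Points just below the graph lie outside the epigraph. This makes the convex hull
  hypothesis applicable at graph points.\<close>

lemma graph_in_frontier_epigraph:
  fixes f :: "'a::real_normed_vector \<Rightarrow> ereal"
  assumes "f x = ereal c"
  shows "(x, c) \<in> frontier (ext_epigraph f)"
proof -
  have "(x, c) \<in> ext_epigraph f"
    using assms by (simp add: ext_epigraph_def)
  moreover have "(x, c) \<notin> interior (ext_epigraph f)"
  proof
    assume "(x, c) \<in> interior (ext_epigraph f)"
    then obtain e where e: "e > 0" "ball (x, c) e \<subseteq> ext_epigraph f"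
      by (auto simp: mem_interior)
    have "(x, c - e / 2) \<in> ball (x, c) e"
      using e(1) by (simp add: dist_Pair_Pair dist_real_def)
    then have "(x, c - e / 2) \<in> ext_epigraph f"
      using e(2) by blast
    then show False
      using assms e(1) by (simp add: ext_epigraph_def)
  qed
  ultimately show ?thesis
    using closure_subset by (auto simp: frontier_def)
qed

text \<open>The segment is horizontal, so \<open>b\<close> drops out when distances are compared.
  With \<open>v = z - x\<close>, expanding squares at parameter \<open>t\<close> gives
  \<open>2 * \<alpha> * (y \<bullet> v) \<le> t * (v \<bullet> v)\<close>; then \<open>t\<close>
  tends to 0.\<close>

lemma prox_normal_inner_le:
  fixes f :: "'a::real_inner \<Rightarrow> ereal"
  assumes normal: "(y, b) \<in> prox_normal_cone (ext_epigraph f) (x, c)"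
    and segment: "closed_segment (x, c) (z, c) \<subseteq> ext_epigraph f"
  shows "y \<bullet> z \<le> y \<bullet> x"
proof -
  obtain \<alpha> where \<alpha>: "\<alpha> > 0" and min: "\<And>w d. f w \<le> ereal d \<Longrightarrow>
      norm (\<alpha> *\<^sub>R y, \<alpha> * b) \<le> norm (x + \<alpha> *\<^sub>R y - w, c + \<alpha> * b - d)"
    using normal unfolding prox_normal_cone_epigraph_iff by blast
  define v where "v = z - x"
  have bound: "2 * \<alpha> * (y \<bullet> v) \<le> t * (v \<bullet> v)" if t: "0 < t" "t < 1" for t
  proof -
    have "(x + t *\<^sub>R v, c) \<in> closed_segment (x, c) (z, c)"
      unfolding in_segment using t by (auto intro!: exI[of _ t] simp: v_def algebra_simps)
    then have "f (x + t *\<^sub>R v) \<le> ereal c"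
      using segment by (auto simp: ext_epigraph_def)
    from min[OF this] have "norm (\<alpha> *\<^sub>R y) \<le> norm (\<alpha> *\<^sub>R y - t *\<^sub>R v)"
      by (simp add: norm_Pair)
    then have "(\<alpha> *\<^sub>R y) \<bullet> (\<alpha> *\<^sub>R y) \<le> (\<alpha> *\<^sub>R y - t *\<^sub>R v) \<bullet> (\<alpha> *\<^sub>R y - t *\<^sub>R v)"
      by (simp only: norm_le)
    then have "t * (2 * \<alpha> * (y \<bullet> v)) \<le> t * (t * (v \<bullet> v))"
      by (simp add: inner_diff inner_commute algebra_simps)
    then show ?thesis
      using t by simp
  qed
  have "((\<lambda>t. t * (v \<bullet> v)) \<longlongrightarrow> 0 * (v \<bullet> v)) (at_right 0)"
    by (intro tendsto_intros)
  moreover have "\<forall>\<^sub>F t in at_right 0. 2 * \<alpha> * (y \<bullet> v) \<le> t * (v \<bullet> v)"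
    unfolding eventually_at_right_field using bound by (intro exI[of _ 1]) auto
  ultimately have "2 * \<alpha> * (y \<bullet> v) \<le> 0 * (v \<bullet> v)"
    by (intro tendsto_lowerbound) auto
  then show ?thesis
    using \<alpha> by (simp add: v_def inner_diff_right mult_le_0_iff)
qed

text \<open>Keeping \<open>b\<close> free covers both subdifferentials, with \<open>b\<close> equal
  to -1 and 0.\<close>

lemma (in reflection_chamber) prox_normal_cone_chamber_rep:
  assumes inv: "group_invariant G f"
    and hull: "\<And>z \<beta>. (z, \<beta>) \<in> frontier (ext_epigraph f) \<Longrightarrow>
           convex hull {(g *v z, \<beta>) | g. g \<in> G} \<subseteq> ext_epigraph f"
    and fx: "f x = ereal c"
  shows "(y, b) \<in> prox_normal_cone (ext_epigraph f) (x, c) \<longleftrightarrow>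
    (chamber_rep G U y, b) \<in> prox_normal_cone (ext_epigraph f) (chamber_rep G U x, c) \<and>
    chamber_rep G U x \<bullet> chamber_rep G U y = x \<bullet> y"
proof -
  have "chamber_rep G U x \<bullet> chamber_rep G U y = x \<bullet> y"
    if normal: "(y, b) \<in> prox_normal_cone (ext_epigraph f) (x, c)"
  proof -
    obtain h k where hk: "h \<in> G" "chamber_rep G U x = h *v x" "k \<in> G" "chamber_rep G U y = k *v y"
      using chamber_rep_orbit by metis
    \<comment> \<open>Chosen so that \<open>y \<bullet> (?g *v x)\<close> is the inner product of
      the two representatives.\<close>
    let ?g = "transpose k ** h"
    have "?g \<in> G"
      using hk by (simp add: mult_G transpose_G)
    then have "{(x, c), (?g *v x, c)} \<subseteq> {(g *v x, c) | g. g \<in> G}"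
      using one_G by (auto intro: exI[of _ "mat 1"])
    then have "closed_segment (x, c) (?g *v x, c) \<subseteq> ext_epigraph f"
      using hull[OF graph_in_frontier_epigraph[of f, OF fx]] hull_mono
      unfolding segment_convex_hull by blast
    then have "y \<bullet> (?g *v x) \<le> y \<bullet> x"
      by (rule prox_normal_inner_le[OF normal])
    moreover have "chamber_rep G U x \<bullet> chamber_rep G U y = y \<bullet> (?g *v x)"
      using inner_transpose_G[OF hk(3), of y "h *v x"] hk
      by (simp add: inner_commute flip: matrix_vector_mul_assoc)
    ultimately show ?thesis
      using inner_le_inner_chamber_rep[of x y] by (simp add: inner_commute)
  qed
  moreover have "(chamber_rep G U y, b) \<in> prox_normal_cone (ext_epigraph f) (chamber_rep G U x, c) \<longleftrightarrow>
      (y, b) \<in> prox_normal_cone (ext_epigraph f) (x, c)"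
    if inner: "chamber_rep G U x \<bullet> chamber_rep G U y = x \<bullet> y"
  proof -
    obtain g where "g \<in> G" "g *v x = chamber_rep G U x" "g *v y = chamber_rep G U y"
      using simultaneous_chamber_rep[OF inner] .
    then show ?thesis
      using prox_normal_cone_epigraph_group[OF inv _ orthogonal_G, of g y b x c] by simp
  qed
  ultimately show ?thesis
    by blast
qed

theorem theorem4:
  fixes G :: "(real ^ 'n ^ 'n) set"
    and U :: "(real ^ 'n) set"
    and f :: "real ^ 'n \<Rightarrow> ereal"
  assumes "finite_reflection_group G"
    and "positive_root_system G U"
    and "\<And>x. f x \<noteq> -\<infinity>"
    and "group_invariant G f"
    and "\<And>z \<beta>. (z, \<beta>) \<in> frontier (ext_epigraph f) \<Longrightarrow>
           convex hull {(g *v z, \<beta>) | g. g \<in> G} \<subseteq> ext_epigraph f"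
  shows "\<forall>x y. f x < \<infinity> \<longrightarrow>
           (y \<in> prox_subdiff f x \<longleftrightarrow>
             chamber_rep G U y \<in> prox_subdiff f (chamber_rep G U x) \<and>
             chamber_rep G U x \<bullet> chamber_rep G U y = x \<bullet> y) \<and>
           (y \<in> sing_prox_subdiff f x \<longleftrightarrow>
             chamber_rep G U y \<in> sing_prox_subdiff f (chamber_rep G U x) \<and>
             chamber_rep G U x \<bullet> chamber_rep G U y = x \<bullet> y)"
proof (intro allI impI)
  fix x y :: "real ^ 'n"
  assume "f x < \<infinity>"
  then obtain c where c: "f x = ereal c"
    using assms(3)[of x] by (cases "f x") auto
  interpret reflection_chamber G U
    using assms(1,2) by unfold_locales
  \<comment> \<open>Thus \<open>real_of_ereal\<close> returns the true value \<open>c\<close> at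
    both points, not its default.\<close>
  have "f (chamber_rep G U x) = ereal c"
    using chamber_rep_orbit[of x] assms(4) c by (auto simp: group_invariant_def)
  then show "(y \<in> prox_subdiff f x \<longleftrightarrow>
             chamber_rep G U y \<in> prox_subdiff f (chamber_rep G U x) \<and>
             chamber_rep G U x \<bullet> chamber_rep G U y = x \<bullet> y) \<and>
           (y \<in> sing_prox_subdiff f x \<longleftrightarrow>
             chamber_rep G U y \<in> sing_prox_subdiff f (chamber_rep G U x) \<and>
             chamber_rep G U x \<bullet> chamber_rep G U y = x \<bullet> y)"
    using prox_normal_cone_chamber_rep[OF assms(4,5) c] c
    by (simp add: prox_subdiff_def sing_prox_subdiff_def)
qed

end
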